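(* For any connected graph $G$ of order $n\geq2$ and size $m$, $$\chi_{i}(G)\geq \frac{1}{2}+\sqrt{\frac{1}{4}+\frac{2m-n}{\rho^{\rm o}(G)}}.$$ Equality holds if and only if $G\in \Theta_r$.
   Context: All graphs are finite and simple. The order of a graph is its number of vertices and its size is its number of edges. An injective $k$-coloring function of a graph $G$ is a function $f:V(G)\to\{1,\dots,k\}$ such that no vertex $v$ is adjacent to two distinct vertices $u$ and $w$ with $f(u)=f(w)$ (adjacent vertices may receive the same color). The injective chromatic number $\chi_i(G)$ is the minimum $k$ for which $G$ admits an injective $k$-coloring function. An open packing in $G$ is a set $B\subseteq V(G)$ such that $N_G(u)\cap N_G(v)=\emptyset$ for any two distinct $u,v\in B$, where $N_G(\cdot)$ denotes the open neighborhood. The open packing number $\rho^{\rm o}(G)$ is the maximum cardinality of an open packing in $G$. For disjoint $A,B\subseteq V(G)$, $[A,B]$ denotes the set of all edges of $G$ with one end-vertex in $A$ and the other in $B$. A matching is a (possibly empty) set of pairwise non-incident edges. The family $\Theta$ consists of all graphs $G$ obtained as follows. Begin with any graphs $H_1,\dots,H_t$ ($t\ge 1$, each with at least one vertex) of maximum degree at most $1$, such that at least one of them, say $H_k$, contains at least one edge. Let $v$ be a non-isolated vertex of $H_k$. Let $G$ be obtained from the disjoint union $H_1+\cdots+H_t$ by (a) joining $v$ by an edge to precisely one vertex of $H_i$ for each $1\le i\le t$ with $i\neq k$, and (b) adding some edges (possibly none) with one end-vertex in $V(H_i)$ and the other one in $V(H_j)$, $i\ne j$, such that in the resulting graph $G$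 the set $[V(H_i),V(H_j)]$ is a matching for each $1\leq i\neq j\leq t$ (the empty set is allowed as a matching). $\Theta_r$ denotes the family of all regular graphs (of any degree) in $\Theta$. *)

theory Defs
  imports Complex_Main "HOL-Library.Disjoint_Sets" "Graph_Theory.Pair_Digraph" "Graph_Theory.Digraph_Component"
begin

text \<open>
  A finite simple graph is a \<^const>\<open>pair_graph\<close>, i.e. a finite, loop-free, symmetric digraph without
  parallel arcs: every undirected edge \<open>{u, v}\<close> is represented by the two arcs \<open>(u, v)\<close> and
  \<open>(v, u)\<close>. Hence the degree of a vertex is its \<^const>\<open>out_degree\<close>, whereas the size of the
  graph has to be counted on the set \<open>uedges\<close> of undirected edges.
\<close>

definition uedges :: "'a pair_pre_digraph \<Rightarrow> 'a set set" where
  "uedges G = {{u, v} | u v. (u, v) \<in> parcs G}"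

definition graph_order :: "'a pair_pre_digraph \<Rightarrow> nat" where
  "graph_order G = card (pverts G)"

definition graph_size :: "'a pair_pre_digraph \<Rightarrow> nat" where
  "graph_size G = card (uedges G)"

definition open_nbhd :: "'a pair_pre_digraph \<Rightarrow> 'a \<Rightarrow> 'a set" where
  "open_nbhd G v = {u. (v, u) \<in> parcs G}"

definition regular_graph :: "'a pair_pre_digraph \<Rightarrow> bool" where
  "regular_graph G \<longleftrightarrow> (\<exists>r. \<forall>v\<in>pverts G. out_degree (with_proj G) v = r)"

definition injective_coloring :: "'a pair_pre_digraph \<Rightarrow> nat \<Rightarrow> ('a \<Rightarrow> nat) \<Rightarrow> bool" where
  "injective_coloring G k f \<longleftrightarrow>
     (\<forall>v\<in>pverts G. f v \<in> {1..k}) \<and>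
     \<not> (\<exists>v\<in>pverts G. \<exists>u\<in>open_nbhd G v. \<exists>w\<in>open_nbhd G v. u \<noteq> w \<and> f u = f w)"

definition injective_chromatic_number :: "'a pair_pre_digraph \<Rightarrow> nat" where
  "injective_chromatic_number G = (LEAST k. \<exists>f. injective_coloring G k f)"

definition open_packing :: "'a pair_pre_digraph \<Rightarrow> 'a set \<Rightarrow> bool" where
  "open_packing G B \<longleftrightarrow>
     B \<subseteq> pverts G \<and>
     (\<forall>u\<in>B. \<forall>v\<in>B. u \<noteq> v \<longrightarrow> open_nbhd G u \<inter> open_nbhd G v = {})"

definition open_packing_number :: "'a pair_pre_digraph \<Rightarrow> nat" where
  "open_packing_number G = Max {card B | B. open_packing G B}"

definition edges_between :: "'a pair_pre_digraph \<Rightarrow> 'a set \<Rightarrow> 'a set \<Rightarrow> 'a set set" where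
  "edges_between G A B = {e \<in> uedges G. \<exists>a\<in>A. \<exists>b\<in>B. e = {a, b}}"

definition matching :: "'a set set \<Rightarrow> bool" where
  "matching M \<longleftrightarrow> (\<forall>e\<in>M. \<forall>e'\<in>M. e \<noteq> e' \<longrightarrow> e \<inter> e' = {})"

text \<open>
  The disjoint union of the graphs \<open>H i\<close> is rendered by requiring their vertex sets to be pairwise
  disjoint, so that membership in \<open>Theta\<close> is invariant under isomorphism. The vertex \<open>w i\<close> is the
  one of \<open>H i\<close> to which \<open>v\<close> is joined, and \<open>F\<close> is the set of further edges that are added. A
  \<^const>\<open>pair_graph\<close> is determined by \<^const>\<open>pverts\<close> and \<^const>\<open>uedges\<close>.
\<close>

definition Theta :: "'a pair_pre_digraph set" where
  "Theta = {G. pair_graph G \<and>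
     (\<exists>(t::nat) (H :: nat \<Rightarrow> 'a pair_pre_digraph) k v w F.
        t \<ge> 1 \<and>
        (\<forall>i\<in>{1..t}. pair_graph (H i) \<and> pverts (H i) \<noteq> {} \<and>
           (\<forall>u\<in>pverts (H i). out_degree (with_proj (H i)) u \<le> 1)) \<and>
        disjoint_family_on (\<lambda>i. pverts (H i)) {1..t} \<and>
        k \<in> {1..t} \<and> v \<in> pverts (H k) \<and> open_nbhd (H k) v \<noteq> {} \<and>
        (\<forall>i\<in>{1..t} - {k}. w i \<in> pverts (H i)) \<and>
        (\<forall>e\<in>F. \<exists>i\<in>{1..t}. \<exists>j\<in>{1..t}. i \<noteq> j \<and>
           (\<exists>x\<in>pverts (H i). \<exists>y\<in>pverts (H j). e = {x, y})) \<and>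
        pverts G = (\<Union>i\<in>{1..t}. pverts (H i)) \<and>
        uedges G = (\<Union>i\<in>{1..t}. uedges (H i)) \<union> (\<lambda>i. {v, w i}) ` ({1..t} - {k}) \<union> F \<and>
        (\<forall>i\<in>{1..t}. \<forall>j\<in>{1..t}. i \<noteq> j \<longrightarrow>
           matching (edges_between G (pverts (H i)) (pverts (H j)))))}"

definition Theta_r :: "'a pair_pre_digraph set" where
  "Theta_r = {G \<in> Theta. regular_graph G}"

end

theory Submission
  imports Defs
begin

text \<open>
  Let \<open>k\<close> be the injective chromatic number and \<open>\<rho>\<close> the open packing number. An optimal
  injective coloring \<open>f\<close> is injective on every open neighborhood, so all degrees are at most
  \<open>k\<close> and \<open>2 m \<le> k n\<close>; its color classes are open packings, so \<open>n \<le> k \<rho>\<close>. Hence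
  \<open>2 m - n \<le> (k - 1) n \<le> k (k - 1) \<rho>\<close>, which is the bound. Equality forces \<open>G\<close> to be
  \<open>k\<close>-regular; then every vertex has exactly one neighbor in each color class, and the classes
  are the graphs \<open>H i\<close> of a \<open>Theta\<close>-decomposition. Conversely, the parts of a
  \<open>Theta\<close>-decomposition are the classes of an injective \<open>t\<close>-coloring and its distinguished
  vertex has degree at least \<open>t\<close>, so a regular member of \<open>Theta\<close> is \<open>t\<close>-regular with \<open>k = t\<close>.
  Moreover \<open>t \<rho> \<le> n\<close>, because the neighborhoods of the vertices of an open packing are disjoint,
  and equality holds throughout.
\<close>

section \<open>Degrees and the size of a graph\<close>

lemma out_degree_eq_card_open_nbhd:
  "out_degree (with_proj G) v = card (open_nbhd G v)"
proof -
  have "out_arcs (with_proj G) v = Pair v ` open_nbhd G v"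
    by (auto simp: out_arcs_def open_nbhd_def)
  then show ?thesis
    by (simp add: out_degree_def card_image inj_on_def)
qed

lemma (in pair_graph) uedge_iff: "{u, v} \<in> uedges G \<longleftrightarrow> (u, v) \<in> parcs G"
  by (auto simp: uedges_def doubleton_eq_iff intro: arcs_symmetric)

lemma (in pair_graph) open_nbhd_subset: "open_nbhd G v \<subseteq> pverts G"
  by (auto simp: open_nbhd_def dest: in_arcsD2)

lemma (in pair_graph) finite_open_nbhd: "finite (open_nbhd G v)"
  using open_nbhd_subset pair_finite_verts finite_subset by blast

text \<open>The arcs are counted twice: by tail, which gives the degree sum, and by underlying edge,
  where each fiber consists of two arcs that differ because there are no loops.\<close>

lemma (in pair_graph) handshake:
  "2 * graph_size G = (\<Sum>v\<in>pverts G. card (open_nbhd G v))"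
proof -
  have arcs: "parcs G = Sigma (pverts G) (open_nbhd G)"
    by (auto simp: open_nbhd_def dest: in_arcsD1)
  let ?e = "\<lambda>a. {fst a, snd a}"
  have img: "?e ` parcs G = uedges G"
    by (force simp: uedges_def)
  have "card {a \<in> parcs G. ?e a = e} = 2" if "e \<in> uedges G" for e
  proof -
    from that obtain u v where uv: "e = {u, v}" "(u, v) \<in> parcs G"
      by (auto simp: uedges_def)
    then have "{a \<in> parcs G. ?e a = e} = {(u, v), (v, u)}"
      by (auto simp: doubleton_eq_iff intro: arcs_symmetric)
    moreover have "u \<noteq> v"
      using uv no_loops' by blast
    ultimately show ?thesis
      by simp
  qed
  then have "(\<Sum>e\<in>uedges G. card {a \<in> parcs G. ?e a = e}) = 2 * card (uedges G)"
    by simp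
  moreover have "(\<Sum>e\<in>?e ` parcs G. sum (\<lambda>_. 1::nat) {a \<in> parcs G. ?e a = e})
      = sum (\<lambda>_. 1) (parcs G)"
    using sum.image_gen[OF pair_finite_arcs, of "\<lambda>_. 1::nat" ?e] by simp
  ultimately have "card (parcs G) = 2 * card (uedges G)"
    by (simp add: img)
  moreover have "card (parcs G) = (\<Sum>v\<in>pverts G. card (open_nbhd G v))"
    unfolding arcs using pair_finite_verts finite_open_nbhd by (intro card_SigmaI) auto
  ultimately show ?thesis
    by (simp add: graph_size_def)
qed

section \<open>Injective colorings\<close>

lemma injective_coloring_iff:
  "injective_coloring G k f \<longleftrightarrow>
     f ` pverts G \<subseteq> {1..k} \<and> (\<forall>v\<in>pverts G. inj_on f (open_nbhd G v))"
  unfolding injective_coloring_def inj_on_def image_subset_iff by meson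

lemma injective_chromatic_number_le:
  "injective_coloring G k f \<Longrightarrow> injective_chromatic_number G \<le> k"
  unfolding injective_chromatic_number_def by (auto intro: Least_le)

text \<open>Giving all vertices different colors is an injective coloring, so the set under
  \<open>LEAST\<close> is nonempty.\<close>

lemma (in pair_graph) injective_chromatic_number_attained:
  "\<exists>f. injective_coloring G (injective_chromatic_number G) f"
proof -
  obtain g where g: "bij_betw g (pverts G) {0..<card (pverts G)}"
    using ex_bij_betw_finite_nat[OF pair_finite_verts] by blast
  \<comment> \<open>\<open>Suc\<close> shifts the numbering \<open>g\<close>, which starts at 0, to
    colors that start at 1.\<close>
  have "injective_coloring G (card (pverts G)) (Suc \<circ> g)"
    unfolding injective_coloring_iff
  proof
    show "(Suc \<circ> g) ` pverts G \<subseteq> {1..card (pverts G)}"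
      using g by (auto simp: bij_betw_def Suc_le_eq)
    have "inj_on (Suc \<circ> g) (pverts G)"
      using g by (auto simp: bij_betw_def inj_on_def)
    then show "\<forall>v\<in>pverts G. inj_on (Suc \<circ> g) (open_nbhd G v)"
      using open_nbhd_subset inj_on_subset by blast
  qed
  then show ?thesis
    unfolding injective_chromatic_number_def
    by (intro LeastI_ex[of "\<lambda>k. \<exists>f. injective_coloring G k f"]) blast
qed

section \<open>Decompositions that witness membership in \<open>Theta\<close>\<close>

text \<open>Names the matrix of the existential statement in \<open>Theta\<close>, with the
  witnesses as arguments, so that it can be assembled and taken apart as one fact.\<close>

definition Theta_decomposition ::
  "'a pair_pre_digraph \<Rightarrow> nat \<Rightarrow> (nat \<Rightarrow> 'a pair_pre_digraph) \<Rightarrow> nat \<Rightarrow> 'a \<Rightarrow> (nat \<Rightarrow> 'a) \<Rightarrow>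
    'a set set \<Rightarrow> bool" where
  "Theta_decomposition G t H k v w F \<longleftrightarrow>
     t \<ge> 1 \<and>
     (\<forall>i\<in>{1..t}. pair_graph (H i) \<and> pverts (H i) \<noteq> {} \<and>
        (\<forall>u\<in>pverts (H i). out_degree (with_proj (H i)) u \<le> 1)) \<and>
     disjoint_family_on (\<lambda>i. pverts (H i)) {1..t} \<and>
     k \<in> {1..t} \<and> v \<in> pverts (H k) \<and> open_nbhd (H k) v \<noteq> {} \<and>
     (\<forall>i\<in>{1..t} - {k}. w i \<in> pverts (H i)) \<and>
     (\<forall>e\<in>F. \<exists>i\<in>{1..t}. \<exists>j\<in>{1..t}. i \<noteq> j \<and>
        (\<exists>x\<in>pverts (H i). \<exists>y\<in>pverts (H j). e = {x, y})) \<and>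
     pverts G = (\<Union>i\<in>{1..t}. pverts (H i)) \<and>
     uedges G = (\<Union>i\<in>{1..t}. uedges (H i)) \<union> (\<lambda>i. {v, w i}) ` ({1..t} - {k}) \<union> F \<and>
     (\<forall>i\<in>{1..t}. \<forall>j\<in>{1..t}. i \<noteq> j \<longrightarrow>
        matching (edges_between G (pverts (H i)) (pverts (H j))))"

lemma Theta_iff:
  "G \<in> Theta \<longleftrightarrow> pair_graph G \<and> (\<exists>t H k v w F. Theta_decomposition G t H k v w F)"
  unfolding Theta_def Theta_decomposition_def mem_Collect_eq by (rule refl)

section \<open>Open packings and color classes\<close>

context pair_graph
begin

lemma finite_open_packing_cards: "finite {card B | B. open_packing G B}"
proof -
  have "{card B | B. open_packing G B} \<subseteq> card ` Pow (pverts G)"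
    by (auto simp: open_packing_def)
  then show ?thesis
    using pair_finite_verts finite_subset by blast
qed

lemma card_le_open_packing_number:
  "open_packing G B \<Longrightarrow> card B \<le> open_packing_number G"
  unfolding open_packing_number_def using finite_open_packing_cards by (auto intro: Max_ge)

lemma open_packing_number_attained:
  obtains B where "open_packing G B" "card B = open_packing_number G"
proof -
  have "open_packing G {}"
    by (simp add: open_packing_def)
  then have "open_packing_number G \<in> {card B | B. open_packing G B}"
    unfolding open_packing_number_def using finite_open_packing_cards by (intro Max_in) auto
  then show ?thesis
    using that by auto
qed

lemma open_packing_number_pos:
  assumes "pverts G \<noteq> {}"
  shows "open_packing_number G > 0"
proof -
  obtain v where "v \<in> pverts G"
    using assms by blast
  then have "open_packing G {v}"
    by (simp add: open_packing_def)
  from card_le_open_packing_number[OF this] show ?thesis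
    by simp
qed

text \<open>A common neighbor of two vertices of the same color would be adjacent to two distinct
  vertices of that color.\<close>

lemma color_class_open_packing:
  assumes "injective_coloring G k f"
  shows "open_packing G {x \<in> pverts G. f x = i}"
  unfolding open_packing_def
proof (intro conjI ballI impI)
  fix u v
  assume u: "u \<in> {x \<in> pverts G. f x = i}" and v: "v \<in> {x \<in> pverts G. f x = i}" and "u \<noteq> v"
  show "open_nbhd G u \<inter> open_nbhd G v = {}"
  proof (rule ccontr)
    assume "open_nbhd G u \<inter> open_nbhd G v \<noteq> {}"
    then obtain x where x: "(u, x) \<in> parcs G" "(v, x) \<in> parcs G"
      by (auto simp: open_nbhd_def)
    then have "x \<in> pverts G" "u \<in> open_nbhd G x" "v \<in> open_nbhd G x"
      by (auto simp: open_nbhd_def intro: arcs_symmetric dest: in_arcsD2)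
    then show False
      using assms u v \<open>u \<noteq> v\<close> by (auto simp: injective_coloring_iff inj_on_def)
  qed
qed auto

text \<open>The \<open>k\<close> color classes cover the vertices, and each is an open
  packing.\<close>

lemma order_le_colors_mult_open_packing_number:
  assumes "injective_coloring G k f"
  shows "graph_order G \<le> k * open_packing_number G"
proof -
  have "pverts G = (\<Union>i\<in>{1..k}. {x \<in> pverts G. f x = i})"
    using assms by (auto simp: injective_coloring_iff)
  then have "card (pverts G) \<le> (\<Sum>i\<in>{1..k}. card {x \<in> pverts G. f x = i})"
    by (metis card_UN_le finite_atLeastAtMost)
  also have "\<dots> \<le> (\<Sum>i\<in>{1..k}. open_packing_number G)"
    using assms color_class_open_packing card_le_open_packing_number by (intro sum_mono) blast
  finally show ?thesis
    by (simp add: graph_order_def)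
qed

section \<open>Degree bounds and regularity\<close>

lemma open_nbhd_colors_subset:
  assumes "injective_coloring G k f"
  shows "f ` open_nbhd G v \<subseteq> {1..k}"
  using assms open_nbhd_subset[of v] by (auto simp: injective_coloring_iff)

lemma card_open_nbhd_le:
  assumes "injective_coloring G k f" "v \<in> pverts G"
  shows "card (open_nbhd G v) \<le> k"
proof -
  have "card (open_nbhd G v) = card (f ` open_nbhd G v)"
    using assms by (simp add: injective_coloring_iff card_image)
  also have "\<dots> \<le> card {1..k}"
    using open_nbhd_colors_subset[OF assms(1)] by (intro card_mono) auto
  finally show ?thesis
    by simp
qed

lemma twice_size_le:
  assumes "injective_coloring G k f"
  shows "2 * graph_size G \<le> k * graph_order G"
proof -
  have "(\<Sum>v\<in>pverts G. card (open_nbhd G v)) \<le> (\<Sum>v\<in>pverts G. k)"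
    using assms card_open_nbhd_le by (intro sum_mono) blast
  then show ?thesis
    by (simp add: handshake[symmetric] graph_order_def mult.commute)
qed

text \<open>No degree exceeds \<open>k\<close>, so a degree sum equal to \<open>k\<close> times the
  order leaves no slack at any vertex.\<close>

lemma regular_if_twice_size_eq:
  assumes "injective_coloring G k f" "2 * graph_size G = k * graph_order G" "v \<in> pverts G"
  shows "card (open_nbhd G v) = k"
proof -
  have "(\<Sum>v\<in>pverts G. card (open_nbhd G v)) = (\<Sum>v\<in>pverts G. k)"
    using assms(2) by (simp add: handshake[symmetric] graph_order_def mult.commute)
  then show ?thesis
    using sum_mono_inv[of "\<lambda>v. card (open_nbhd G v)" "pverts G" "\<lambda>_. k" v]
      card_open_nbhd_le[OF assms(1)] assms(3) pair_finite_verts by blast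
qed

text \<open>The vertices of a maximum open packing have pairwise disjoint neighborhoods of
  \<open>t\<close> vertices each.\<close>

lemma degree_mult_open_packing_number_le:
  assumes "\<And>v. v \<in> pverts G \<Longrightarrow> card (open_nbhd G v) = t"
  shows "t * open_packing_number G \<le> graph_order G"
proof -
  obtain B where B: "open_packing G B" "card B = open_packing_number G"
    using open_packing_number_attained .
  have sub: "B \<subseteq> pverts G"
    using B by (simp add: open_packing_def)
  then have "finite B"
    using pair_finite_verts finite_subset by blast
  then have "card (\<Union>b\<in>B. open_nbhd G b) = (\<Sum>b\<in>B. card (open_nbhd G b))"
    using B finite_open_nbhd by (intro card_UN_disjoint) (auto simp: open_packing_def)
  also have "\<dots> = (\<Sum>b\<in>B. t)"
    using assms sub by (intro sum.cong) auto
  finally have "card (\<Union>b\<in>B. open_nbhd G b) = t * card B"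
    by simp
  moreover have "card (\<Union>b\<in>B. open_nbhd G b) \<le> card (pverts G)"
    using open_nbhd_subset pair_finite_verts by (intro card_mono) auto
  ultimately show ?thesis
    using B by (simp add: graph_order_def)
qed

section \<open>From a tight coloring to a decomposition\<close>

text \<open>Every vertex has exactly one neighbor of each color. Hence the classes induce graphs of
  maximum degree at most 1, the edges between two classes form a matching, and any vertex can serve
  as the distinguished one.\<close>

lemma regular_coloring_in_Theta:
  assumes f: "injective_coloring G k f" and ne: "pverts G \<noteq> {}"
    and reg: "\<And>v. v \<in> pverts G \<Longrightarrow> card (open_nbhd G v) = k"
  shows "G \<in> Theta"
proof -
  define H where "H i = \<lparr>pverts = {x \<in> pverts G. f x = i},
    parcs = {(x, y). (x, y) \<in> parcs G \<and> f x = i \<and> f y = i}\<rparr>" for i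
  \<comment> \<open>\<open>F\<close> takes all edges between different classes, the joining edges
    \<open>{v, w i}\<close> included; the union that describes \<open>uedges G\<close> absorbs the
    repetition.\<close>
  define F where "F = {{x, y} | x y. (x, y) \<in> parcs G \<and> f x \<noteq> f y}"
  have pv: "pverts (H i) = {x \<in> pverts G. f x = i}" for i
    by (simp add: H_def)
  have pa: "(x, y) \<in> parcs (H i) \<longleftrightarrow> (x, y) \<in> parcs G \<and> f x = i \<and> f y = i" for i x y
    by (simp add: H_def)
  have inj: "inj_on f (open_nbhd G x)" if "x \<in> pverts G" for x
    using f that by (simp add: injective_coloring_iff)
  \<comment> \<open>The \<open>k\<close> neighbors have distinct colors among \<open>k\<close>
    colors, so every color occurs.\<close>
  have surj: "f ` open_nbhd G x = {1..k}" if "x \<in> pverts G" for x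
    using open_nbhd_colors_subset[OF f] reg[OF that] card_image[OF inj[OF that]]
    by (intro card_subset_eq) auto
  have nbr: "\<exists>y. (x, y) \<in> parcs G \<and> f y = i" if "x \<in> pverts G" "i \<in> {1..k}" for x i
  proof -
    have "i \<in> f ` open_nbhd G x"
      using surj that by simp
    then show ?thesis
      by (auto simp: open_nbhd_def)
  qed
  have uniq: "y = z" if "(x, y) \<in> parcs G" "(x, z) \<in> parcs G" "f y = f z" for x y z
    using inj[OF in_arcsD1[OF that(1)]] that by (auto simp: inj_on_def open_nbhd_def)
  have col: "f x \<in> {1..k}" if "x \<in> pverts G" for x
    using f that by (auto simp: injective_coloring_iff)
  obtain v where v: "v \<in> pverts G"
    using ne by blast
  obtain w where w: "\<And>i. i \<in> {1..k} \<Longrightarrow> (v, w i) \<in> parcs G \<and> f (w i) = i"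
    using nbr[OF v] by metis
  have H_graph: "pair_graph (H i)" for i
  proof
    show "symmetric (with_proj (H i))"
      unfolding symmetric_def by (rule symI) (auto simp: pa intro: arcs_symmetric)
    show "finite (parcs (H i))"
      using pair_finite_arcs by (rule finite_subset[rotated]) (auto simp: pa)
  qed (use pair_finite_verts in \<open>auto simp: pv pa dest: in_arcsD1 in_arcsD2 no_loops'\<close>)
  have H_deg: "out_degree (with_proj (H i)) u \<le> 1" for i u
  proof -
    have "a = b" if "a \<in> open_nbhd (H i) u" "b \<in> open_nbhd (H i) u" for a b
      using that uniq by (auto simp: open_nbhd_def pa)
    moreover have "finite (open_nbhd (H i) u)"
      using finite_open_nbhd by (rule finite_subset[rotated]) (auto simp: open_nbhd_def pa)
    ultimately show ?thesis
      by (simp add: out_degree_eq_card_open_nbhd card_le_Suc0_iff_eq)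
  qed
  have uedges_H: "uedges (H i) = {{x, y} | x y. (x, y) \<in> parcs G \<and> f x = i \<and> f y = i}" for i
    by (simp add: uedges_def pa)
  have between: "\<exists>x y. e = {x, y} \<and> (x, y) \<in> parcs G \<and> f x = i \<and> f y = j"
    if "e \<in> edges_between G (pverts (H i)) (pverts (H j))" for e i j
    using that unfolding edges_between_def pv mem_Collect_eq
    by (metis (mono_tags, lifting) mem_Collect_eq uedge_iff)
  have match: "matching (edges_between G (pverts (H i)) (pverts (H j)))" if "i \<noteq> j" for i j
    unfolding matching_def
  proof (intro ballI impI)
    fix e e'
    assume "e \<in> edges_between G (pverts (H i)) (pverts (H j))"
      and "e' \<in> edges_between G (pverts (H i)) (pverts (H j))" and "e \<noteq> e'"
    then obtain x y x' y' where e: "e = {x, y}" "(x, y) \<in> parcs G" "f x = i" "f y = j"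
      "e' = {x', y'}" "(x', y') \<in> parcs G" "f x' = i" "f y' = j"
      using between by metis
    \<comment> \<open>If \<open>x = x'\<close>, then \<open>y\<close> and \<open>y'\<close> are
      neighbors of \<open>x\<close> of the same color \<open>j\<close>, so the two edges
      coincide.\<close>
    have "x \<noteq> x'"
      using e uniq \<open>e \<noteq> e'\<close> by metis
    moreover have "y \<noteq> y'"
      using e uniq \<open>e \<noteq> e'\<close> arcs_symmetric by metis
    ultimately show "e \<inter> e' = {}"
      using e \<open>i \<noteq> j\<close> by auto
  qed
  have "k \<ge> 1"
    using col[OF v] by simp
  have H_ne: "pverts (H i) \<noteq> {}" if "i \<in> {1..k}" for i
    using w[OF that] by (auto simp: pv dest: in_arcsD2)
  have disj: "disjoint_family_on (\<lambda>i. pverts (H i)) {1..k}"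
    by (auto simp: disjoint_family_on_def pv)
  \<comment> \<open>The neighbor of \<open>v\<close> that shares its color makes \<open>v\<close>
    non-isolated in its own class.\<close>
  have v_H: "v \<in> pverts (H (f v))" "open_nbhd (H (f v)) v \<noteq> {}"
    using v nbr[OF v col[OF v]] by (auto simp: pv pa open_nbhd_def)
  have w_H: "\<forall>i\<in>{1..k} - {f v}. w i \<in> pverts (H i)"
    using w in_arcsD2 unfolding pv by blast
  have F_between: "\<forall>e\<in>F. \<exists>i\<in>{1..k}. \<exists>j\<in>{1..k}. i \<noteq> j \<and>
      (\<exists>x\<in>pverts (H i). \<exists>y\<in>pverts (H j). e = {x, y})"
  proof
    fix e
    assume "e \<in> F"
    then obtain x y where xy: "e = {x, y}" "(x, y) \<in> parcs G" "f x \<noteq> f y"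
      by (auto simp: F_def)
    then have "x \<in> pverts G" "y \<in> pverts G"
      by (auto dest: in_arcsD1 in_arcsD2)
    then have "f x \<in> {1..k}" "f y \<in> {1..k}" "x \<in> pverts (H (f x))" "y \<in> pverts (H (f y))"
      using col by (auto simp: pv)
    then show "\<exists>i\<in>{1..k}. \<exists>j\<in>{1..k}. i \<noteq> j \<and>
        (\<exists>x\<in>pverts (H i). \<exists>y\<in>pverts (H j). e = {x, y})"
      using xy by blast
  qed
  have verts: "pverts G = (\<Union>i\<in>{1..k}. pverts (H i))"
    using col by (auto simp: pv)
  have edges: "uedges G =
      (\<Union>i\<in>{1..k}. uedges (H i)) \<union> (\<lambda>i. {v, w i}) ` ({1..k} - {f v}) \<union> F" (is "_ = ?R")
  proof
    show "?R \<subseteq> uedges G"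
      using w by (auto simp: uedges_H F_def uedge_iff)
    show "uedges G \<subseteq> ?R"
    proof
      fix e
      assume "e \<in> uedges G"
      then obtain x y where xy: "e = {x, y}" "(x, y) \<in> parcs G"
        by (auto simp: uedges_def)
      show "e \<in> ?R"
      proof (cases "f x = f y")
        case True
        then have "e \<in> uedges (H (f x))"
          using xy by (auto simp: uedges_H)
        moreover have "f x \<in> {1..k}"
          using col in_arcsD1[OF xy(2)] by blast
        ultimately show ?thesis
          by blast
      next
        case False
        then show ?thesis
          using xy by (auto simp: F_def)
      qed
    qed
  qed
  have H_all: "\<forall>i\<in>{1..k}. pair_graph (H i) \<and> pverts (H i) \<noteq> {} \<and>
      (\<forall>u\<in>pverts (H i). out_degree (with_proj (H i)) u \<le> 1)"
    using H_graph H_ne H_deg by blast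
  have match_all: "\<forall>i\<in>{1..k}. \<forall>j\<in>{1..k}. i \<noteq> j \<longrightarrow>
      matching (edges_between G (pverts (H i)) (pverts (H j)))"
    using match by blast
  have f_v: "f v \<in> {1..k}"
    using col v by blast
  have "Theta_decomposition G k H (f v) v w F"
    unfolding Theta_decomposition_def by (intro conjI; fact)
  then show ?thesis
    using pair_graph unfolding Theta_iff by blast
qed

end

section \<open>From a decomposition to a coloring\<close>

text \<open>Each vertex is colored by the index of its part. A vertex has at most one neighbor in
  its own part by the degree bound, and at most one in any other part by the matching condition. The
  distinguished vertex has a neighbor in each of the \<open>t\<close> parts.\<close>

lemma Theta_obtain_coloring:
  assumes "G \<in> Theta"
  obtains t f v where "injective_coloring G t f" "v \<in> pverts G" "t \<le> card (open_nbhd G v)"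
proof -
  from assms obtain t H k v w F where G: "pair_graph G"
    and dec: "Theta_decomposition G t H k v w F"
    by (auto simp: Theta_iff)
  from dec have
    H: "\<forall>i\<in>{1..t}. pair_graph (H i) \<and> pverts (H i) \<noteq> {} \<and>
           (\<forall>u\<in>pverts (H i). out_degree (with_proj (H i)) u \<le> 1)" and
    disj: "disjoint_family_on (\<lambda>i. pverts (H i)) {1..t}" and
    k: "k \<in> {1..t}" "v \<in> pverts (H k)" "open_nbhd (H k) v \<noteq> {}" and
    w: "\<forall>i\<in>{1..t} - {k}. w i \<in> pverts (H i)" and
    F: "\<forall>e\<in>F. \<exists>i\<in>{1..t}. \<exists>j\<in>{1..t}. i \<noteq> j \<and>
           (\<exists>x\<in>pverts (H i). \<exists>y\<in>pverts (H j). e = {x, y})" and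
    verts: "pverts G = (\<Union>i\<in>{1..t}. pverts (H i))" and
    edges: "uedges G = (\<Union>i\<in>{1..t}. uedges (H i)) \<union> (\<lambda>i. {v, w i}) ` ({1..t} - {k}) \<union> F" and
    match: "\<forall>i\<in>{1..t}. \<forall>j\<in>{1..t}. i \<noteq> j \<longrightarrow>
      matching (edges_between G (pverts (H i)) (pverts (H j)))"
    unfolding Theta_decomposition_def by (-) (elim conjE, assumption)+
  interpret pair_graph G by (fact G)
  define f where "f x = (THE i. i \<in> {1..t} \<and> x \<in> pverts (H i))" for x
  have f_eq: "f x = i" if "i \<in> {1..t}" "x \<in> pverts (H i)" for x i
    unfolding f_def using that disj
    by (intro the_equality) (auto simp: disjoint_family_on_def disjoint_iff, metis atLeastAtMost_iff One_nat_def)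
  have f_in: "f x \<in> {1..t} \<and> x \<in> pverts (H (f x))" if "x \<in> pverts G" for x
    using that f_eq verts by auto
  \<comment> \<open>Joining edges and edges of \<open>F\<close> run between different parts, so an
    edge with both ends in one part is an edge of that part.\<close>
  have inner: "(x, y) \<in> parcs (H (f x))" if xy: "(x, y) \<in> parcs G" and same: "f x = f y" for x y
  proof -
    have "{x, y} \<in> uedges G"
      using xy by (simp add: uedge_iff)
    moreover have "{x, y} \<notin> (\<lambda>i. {v, w i}) ` ({1..t} - {k})"
    proof
      assume "{x, y} \<in> (\<lambda>i. {v, w i}) ` ({1..t} - {k})"
      then obtain i where i: "i \<in> {1..t} - {k}" "{x, y} = {v, w i}"
        by blast
      then have "f (w i) = i" "f v = k"
        using f_eq k(1,2) w by blast+
      with i same show False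
        by (auto simp: doubleton_eq_iff)
    qed
    moreover have "{x, y} \<notin> F"
    proof
      assume "{x, y} \<in> F"
      from bspec[OF F this] show False
      proof (elim bexE conjE)
        fix i j a b
        assume ij: "i \<in> {1..t}" "j \<in> {1..t}" "a \<in> pverts (H i)" "b \<in> pverts (H j)"
          and "i \<noteq> j" "{x, y} = {a, b}"
        moreover have "f a = i" "f b = j"
          using f_eq ij by simp_all
        ultimately show False
          using same by (auto simp: doubleton_eq_iff)
      qed
    qed
    ultimately obtain i where i: "i \<in> {1..t}" "{x, y} \<in> uedges (H i)"
      using edges by blast
    interpret Hi: pair_graph "H i" using H i by blast
    have "(x, y) \<in> parcs (H i)"
      using i Hi.uedge_iff by blast
    moreover have "f x = i"
      using f_eq i(1) Hi.in_arcsD1[OF calculation] by blast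
    ultimately show ?thesis
      by simp
  qed
  have "injective_coloring G t f"
    unfolding injective_coloring_iff
  proof (intro conjI ballI inj_onI)
    show "f ` pverts G \<subseteq> {1..t}"
      using f_in by blast
    fix x y z
    assume x: "x \<in> pverts G" and y: "y \<in> open_nbhd G x" and z: "z \<in> open_nbhd G x"
      and eq: "f y = f z"
    have arcs: "(x, y) \<in> parcs G" "(x, z) \<in> parcs G"
      using y z by (auto simp: open_nbhd_def)
    have yz: "y \<in> pverts G" "z \<in> pverts G"
      using y z open_nbhd_subset by auto
    show "y = z"
    proof (cases "f x = f y")
      case True
      then have "y \<in> open_nbhd (H (f x)) x" "z \<in> open_nbhd (H (f x)) x"
        using inner[OF arcs(1)] inner[OF arcs(2)] eq by (simp_all add: open_nbhd_def)
      moreover interpret Hx: pair_graph "H (f x)"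
        using H f_in x by blast
      have "card (open_nbhd (H (f x)) x) \<le> Suc 0"
        using H f_in[OF x] by (simp add: out_degree_eq_card_open_nbhd)
      ultimately show ?thesis
        using Hx.finite_open_nbhd by (simp add: card_le_Suc0_iff_eq)
    next
      case False
      \<comment> \<open>Both edges lie in one matching and share the vertex \<open>x\<close>, so
        they are equal.\<close>
      have "{x, y} \<in> edges_between G (pverts (H (f x))) (pverts (H (f y)))"
        "{x, z} \<in> edges_between G (pverts (H (f x))) (pverts (H (f y)))"
        using arcs f_in[OF x] f_in[OF yz(1)] f_in[OF yz(2)] eq
        by (auto simp: edges_between_def uedge_iff)
      then have "{x, y} = {x, z}"
        using match f_in[OF x] f_in[OF yz(1)] False
        unfolding matching_def by (metis disjoint_iff insertI1)
      then show ?thesis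
        by (auto simp: doubleton_eq_iff)
    qed
  qed
  moreover have v: "v \<in> pverts G"
    using k verts by blast
  moreover have "t \<le> card (open_nbhd G v)"
  proof -
    \<comment> \<open>Color \<open>k\<close> is supplied by a neighbor of \<open>v\<close> inside
      \<open>H k\<close>, any other color \<open>i\<close> by \<open>w i\<close>.\<close>
    have "i \<in> f ` open_nbhd G v" if i: "i \<in> {1..t}" for i
    proof (cases "i = k")
      case True
      obtain y where y: "(v, y) \<in> parcs (H k)"
        using k(3) by (auto simp: open_nbhd_def)
      interpret Hk: pair_graph "H k" using H k by blast
      have "{v, y} \<in> uedges G"
        using edges k(1) y Hk.uedge_iff by blast
      then have "y \<in> open_nbhd G v"
        by (simp add: uedge_iff open_nbhd_def)
      moreover have "f y = k"
        using f_eq k(1) Hk.in_arcsD2[OF y] by blast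
      ultimately show ?thesis
        using True by blast
    next
      case False
      then have "{v, w i} \<in> uedges G"
        using edges i by blast
      then have "w i \<in> open_nbhd G v"
        by (simp add: uedge_iff open_nbhd_def)
      moreover have "f (w i) = i"
        using f_eq w i False by blast
      ultimately show ?thesis
        using image_eqI[of i f "w i"] by simp
    qed
    then have "card {1..t} \<le> card (open_nbhd G v)"
      by (intro surj_card_le[OF finite_open_nbhd] subsetI)
    then show ?thesis
      by simp
  qed
  ultimately show ?thesis
    using that by blast
qed

section \<open>The quadratic inequality and the theorem\<close>

text \<open>
  No lower bound on \<open>y\<close> is needed, since \<open>sqrt\<close> is strictly increasing on all of the reals,
  with negative values at negative arguments.
\<close>

lemma half_plus_sqrt_le_iff:
  fixes k y :: real
  assumes "k \<ge> 1"
  shows "1 / 2 + sqrt (1 / 4 + y) \<le> k \<longleftrightarrow> y \<le> k * (k - 1)"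
    and "k = 1 / 2 + sqrt (1 / 4 + y) \<longleftrightarrow> y = k * (k - 1)"
proof -
  \<comment> \<open>Completing the square: the radicand is the square of \<open>k - 1 / 2\<close>,
    which is nonnegative since \<open>k \<ge> 1\<close>.\<close>
  have sq: "sqrt (1 / 4 + k * (k - 1)) = k - 1 / 2"
    using assms by (intro real_sqrt_unique) (auto simp: power2_eq_square algebra_simps)
  have "1 / 2 + sqrt (1 / 4 + y) \<le> k \<longleftrightarrow> sqrt (1 / 4 + y) \<le> sqrt (1 / 4 + k * (k - 1))"
    unfolding sq by linarith
  then show "1 / 2 + sqrt (1 / 4 + y) \<le> k \<longleftrightarrow> y \<le> k * (k - 1)"
    by simp
  have "k = 1 / 2 + sqrt (1 / 4 + y) \<longleftrightarrow> sqrt (1 / 4 + y) = sqrt (1 / 4 + k * (k - 1))"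
    unfolding sq by linarith
  then show "k = 1 / 2 + sqrt (1 / 4 + y) \<longleftrightarrow> y = k * (k - 1)"
    by simp
qed

theorem theorem6:
  fixes G :: "'a pair_pre_digraph" and n m :: nat
  assumes "pair_graph G"
    and "Digraph_Component.connected (with_proj G)"
    and "graph_order G = n" and "n \<ge> 2"
    and "graph_size G = m"
  shows "real (injective_chromatic_number G) \<ge>
           1 / 2 + sqrt (1 / 4 + (2 * real m - real n) / real (open_packing_number G))
       \<and> (real (injective_chromatic_number G) =
           1 / 2 + sqrt (1 / 4 + (2 * real m - real n) / real (open_packing_number G))
          \<longleftrightarrow> G \<in> Theta_r)"
proof -
  interpret pair_graph G by (fact assms(1))
  define k where "k = injective_chromatic_number G"
  define \<rho> where "\<rho> = open_packing_number G"
  obtain f where f: "injective_coloring G k f"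
    using injective_chromatic_number_attained unfolding k_def by blast
  have ne: "pverts G \<noteq> {}"
    using assms(3,4) by (auto simp: graph_order_def)
  have \<rho>_pos: "\<rho> > 0"
    using ne open_packing_number_pos by (simp add: \<rho>_def)
  have n_le: "n \<le> k * \<rho>"
    using order_le_colors_mult_open_packing_number[OF f] assms(3) by (simp add: \<rho>_def)
  then have k1: "k \<ge> 1"
    using assms(4) by (cases k) auto
  have m_le: "2 * m \<le> k * n"
    using twice_size_le[OF f] assms(3,5) by simp
  have m_real: "2 * real m \<le> real k * real n"
    using m_le by (metis of_nat_le_iff of_nat_mult of_nat_numeral)
  have n_real: "real n \<le> real k * real \<rho>"
    using n_le by (metis of_nat_le_iff of_nat_mult)
  \<comment> \<open>\<open>n \<le> k \<rho>\<close> is multiplied by \<open>k - 1\<close>, which is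
    nonnegative; adding \<open>2 m - n \<le> (k - 1) n\<close> then gives \<open>le\<close>.\<close>
  have step: "(real k - 1) * real n \<le> (real k - 1) * (real k * real \<rho>)"
    using n_real k1 by (intro mult_left_mono) auto
  have le: "2 * real m - real n \<le> real k * (real k - 1) * real \<rho>"
    using m_real step by (simp add: algebra_simps)
  have eq_iff: "2 * real m - real n = real k * (real k - 1) * real \<rho> \<longleftrightarrow> G \<in> Theta_r"
  proof
    assume "2 * real m - real n = real k * (real k - 1) * real \<rho>"
    \<comment> \<open>By \<open>step\<close>, the assumed equality gives
      \<open>2 m - n \<ge> (k - 1) n\<close>, the reverse of \<open>m_real\<close>.\<close>
    then have "2 * real m = real k * real n"
      using m_real step by (simp add: algebra_simps)
    then have "2 * m = k * n"
      by (metis of_nat_eq_iff of_nat_mult of_nat_numeral)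
    then have reg: "card (open_nbhd G v) = k" if "v \<in> pverts G" for v
      using regular_if_twice_size_eq[OF f] assms(3,5) that by simp
    then show "G \<in> Theta_r"
      using regular_coloring_in_Theta[OF f ne reg]
      by (auto simp: Theta_r_def regular_graph_def out_degree_eq_card_open_nbhd)
  next
    assume "G \<in> Theta_r"
    then obtain r where r: "\<And>v. v \<in> pverts G \<Longrightarrow> card (open_nbhd G v) = r" and "G \<in> Theta"
      by (auto simp: Theta_r_def regular_graph_def out_degree_eq_card_open_nbhd)
    then obtain t g v where g: "injective_coloring G t g" "v \<in> pverts G"
      "t \<le> card (open_nbhd G v)"
      using Theta_obtain_coloring by blast
    \<comment> \<open>The chain \<open>k \<le> t \<le> r \<le> k\<close> closes up, with
      \<open>r\<close> the common degree.\<close>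
    have "k \<le> t"
      using injective_chromatic_number_le[OF g(1)] by (simp add: k_def)
    moreover have "r \<le> k"
      using card_open_nbhd_le[OF f g(2)] r[OF g(2)] by simp
    ultimately have rk: "r = k"
      using g(3) r[OF g(2)] by simp
    have "k * \<rho> \<le> n"
      using degree_mult_open_packing_number_le[OF r] assms(3) rk by (simp add: \<rho>_def)
    with n_le have n_eq: "n = k * \<rho>"
      by simp
    have "2 * m = k * n"
      using handshake r rk assms(3,5) by (simp add: graph_order_def)
    then have "2 * real m = real k * real n"
      by (metis of_nat_mult of_nat_numeral)
    then show "2 * real m - real n = real k * (real k - 1) * real \<rho>"
      by (simp add: n_eq algebra_simps)
  qed
  have k_real: "real k \<ge> 1"
    using k1 by simp
  show ?thesis
    unfolding k_def[symmetric] \<rho>_def[symmetric] half_plus_sqrt_le_iff[OF k_real]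
    using le eq_iff \<rho>_pos by (simp add: field_simps)
qed

end
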